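(* Let $n\ge 1$ and let $T\in\mathcal{P}_n$ be a plane tree with $n$ edges. For any node $v$ of $T$, if $v\leadsto u$ (in $T$), then $$\mathsf{lev}_T(v)=\mathsf{lsw}_{\tilde\phi(T)}(u)\quad\text{and}\quad \mathsf{lsw}_T(v)=\mathsf{lev}_{\tilde\phi(T)}(u).$$ Moreover, $\mathsf{deg}_T(v)=\widetilde{\mathsf{deg}}_{\tilde\phi(T)}(u)$.
   Context: **Plane trees.** A plane tree is a rooted tree in which the children of each node are linearly ordered (from left to right). $\mathcal{P}_n$ is the set of plane trees with $n\ge1$ edges. A node without children is a leaf; otherwise it is internal. The nodes of $T\in\mathcal P_n$ are named $0,1,\dots,n$ (only to distinguish them), the root being $0$ and the leftmost child of the root being $1$. Nodes with the same parent are siblings; siblings to the left of a node are its elder siblings, those to the right its younger siblings. **Binary trees and the involution $\tilde\phi$.** A binary tree is a rooted tree in which each node has at most one left child and at most one right child; $\mathcal{B}_n$ is the set of binary trees with $n$ nodes. The bijection $\varphi:\mathcal P_n\to\mathcal B_n$: the nodes of $\varphi(T)$ are the non-root nodes of $T$; its root is the leftmost child of the root of $T$; for non-root nodes $x,y$ of $T$, $y$ is the left child of $x$ in $\varphi(T)$ iff $y$ is the leftmost child of $x$ in $T$, and $y$ is the right child of $x$ in $\varphi(T)$ iff $x$ is the closest elder sibling of $y$ in $T$. For $B\in\mathcal B_n$, $\phi(B)$ is the mirror image of $B$ (same nodes, left and right children exchanged). Put $\tilde\phi=\varphi^{-1}\circ\phi\circ\varphi:\mathcal P_n\to\mathcal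 P_n$. Node names are kept, so $T$ and $\tilde\phi(T)$ have the same node set, both with root $0$. **Complement.** Let $T\in\mathcal P_n$ and $B=\varphi(T)$. Add new nodes to $B$ so that every node of $B$ has exactly two children; the resulting complete binary tree is the complement $\overline B$. The added nodes are named $0',1',\dots,n'$: if the added node is a left child of a node $v$ of $B$, it is named $v'$; if it is a right child of a node $v$ of $B$, it is named $u'$, where $u$ is the parent of $v$ in $T$. The complement $\overline{\phi(B)}$ is defined in the same way using the plane tree $\tilde\phi(T)$, for which $\varphi(\tilde\phi(T))=\phi(B)$. **The relation $\leadsto$.** For every node $v$ of $T$ there is a unique node $u$ of $T$ such that either $v'$ is the right child of $u$ in $\overline B$, or $u'$ is the right child of $v$ in $\overline{\phi(B)}$. One writes $v\leadsto u$. **Statistics of a node $v$ of $T$.** - $\mathsf{lev}_T(v)$ is the number of edges on the path from $v$ to the root. - $\mathsf{lsw}_T(v)$ (left spanning width) is the number of children of $v$ plus the number of edges attached to nodes other than $v$ on the path from $v$ to the root from the left-hand side of the path (equivalently, the number of children of $v$ plus the total number of elder siblings of the non-root nodes on the path from $v$ to the root, $v$ included). - $\mathsf{deg}_T(v)$ is the number of children of $v$. - The dual degree $\widetilde{\mathsf{deg}}_T(v)$ is: $0$ if $v$ is internal; $\mathsf{lev}_T(v)$ if $v$ is a leaf and no node on the path from $v$ to the root has elder siblings; otherwise, the number of nodes from $v$ to the first node having elder siblings (both included) when walking from $v$ to the root. *)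

theory Defs
  imports "HOL-Library.Tree"
begin

datatype 'a ptree = PNode (root: 'a) (branches: "'a ptree list")

fun names :: "'a ptree \<Rightarrow> 'a list" where
  "names (PNode x ts) = x # concat (map names ts)"

text \<open>A plane tree with \<open>n\<close> edges has \<open>n + 1\<close> nodes. Since \<open>1\<close> is required to be the leftmost child
  of the root, \<open>plane_trees 0\<close> is empty.\<close>

definition plane_trees :: "nat \<Rightarrow> nat ptree set" where
  "plane_trees n = {T. distinct (names T) \<and> set_ptree T = {0..n} \<and>
                       (\<exists>us ts. T = PNode 0 (PNode 1 us # ts))}"

text \<open>The children of the node named \<open>v\<close>, from left to right. The names in a plane tree are distinct,
  so at most one of the concatenated lists is nonempty.\<close>

fun children :: "'a ptree \<Rightarrow> 'a \<Rightarrow> 'a list" where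
  "children (PNode x ts) v =
     (if v = x then map root ts else concat (map (\<lambda>t. children t v) ts))"

definition elder_sibling :: "'a ptree \<Rightarrow> 'a \<Rightarrow> 'a \<Rightarrow> bool" where
  "elder_sibling T x y \<longleftrightarrow> (\<exists>w as bs cs. children T w = as @ x # bs @ y # cs)"

definition closest_elder_sibling :: "'a ptree \<Rightarrow> 'a \<Rightarrow> 'a \<Rightarrow> bool" where
  "closest_elder_sibling T x y \<longleftrightarrow> (\<exists>w as bs. children T w = as @ x # y # bs)"

definition parent :: "'a ptree \<Rightarrow> 'a \<Rightarrow> 'a" where
  "parent T v = (THE u. v \<in> set (children T u))"

definition root_path :: "'a ptree \<Rightarrow> 'a \<Rightarrow> 'a list" where
  "root_path T v = (THE p. p \<noteq> [] \<and> hd p = v \<and> last p = root T \<and>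
                           successively (\<lambda>x y. x \<in> set (children T y)) p)"

definition lev :: "'a ptree \<Rightarrow> 'a \<Rightarrow> nat" where
  "lev T v = length (root_path T v) - 1"

text \<open>The counted pairs \<open>(w, x)\<close> are the edges attached to a node \<open>w \<noteq> v\<close> of the path on the
  left-hand side of the path: \<open>x\<close> is an elder sibling of the child of \<open>w\<close> that lies on the path.\<close>

definition lsw :: "'a ptree \<Rightarrow> 'a \<Rightarrow> nat" where
  "lsw T v = length (children T v) +
     card {(w, x). w \<in> set (root_path T v) - {v} \<and> x \<in> set (children T w) \<and>
                   (\<exists>y \<in> set (root_path T v). elder_sibling T x y)}"

definition deg :: "'a ptree \<Rightarrow> 'a \<Rightarrow> nat" where
  "deg T v = length (children T v)"

definition has_elder :: "'a ptree \<Rightarrow> 'a \<Rightarrow> bool" where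
  "has_elder T w \<longleftrightarrow> (\<exists>x. elder_sibling T x w)"

definition dual_deg :: "'a ptree \<Rightarrow> 'a \<Rightarrow> nat" where
  "dual_deg T v =
     (if children T v \<noteq> [] then 0
      else if \<forall>w \<in> set (root_path T v). \<not> has_elder T w then lev T v
      else length (takeWhile (\<lambda>w. \<not> has_elder T w) (root_path T v)) + 1)"

definition left_child :: "'a tree \<Rightarrow> 'a \<Rightarrow> 'a \<Rightarrow> bool" where
  "left_child B x y \<longleftrightarrow> (\<exists>l r t. \<langle>\<langle>l, y, r\<rangle>, x, t\<rangle> \<in> subtrees B)"

definition right_child :: "'a tree \<Rightarrow> 'a \<Rightarrow> 'a \<Rightarrow> bool" where
  "right_child B x y \<longleftrightarrow> (\<exists>l r t. \<langle>t, x, \<langle>l, y, r\<rangle>\<rangle> \<in> subtrees B)"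

definition binary_trees :: "nat \<Rightarrow> nat tree set" where
  "binary_trees n = {B. distinct (preorder B) \<and> set_tree B = {1..n} \<and> (\<exists>l r. B = \<langle>l, 1, r\<rangle>)}"

definition is_varphi :: "'a ptree \<Rightarrow> 'a tree \<Rightarrow> bool" where
  "is_varphi T B \<longleftrightarrow>
     distinct (preorder B) \<and> set_tree B = set_ptree T - {root T} \<and>
     (\<exists>l r. B = \<langle>l, hd (children T (root T)), r\<rangle>) \<and>
     (\<forall>x \<in> set_ptree T - {root T}. \<forall>y \<in> set_ptree T - {root T}.
        (left_child B x y \<longleftrightarrow> (\<exists>cs. children T x = y # cs)) \<and>
        (right_child B x y \<longleftrightarrow> closest_elder_sibling T x y))"

definition varphi :: "'a ptree \<Rightarrow> 'a tree" where
  "varphi T = (THE B. is_varphi T B)"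

text \<open>The inverse is taken on \<open>plane_trees n\<close>; see \<open>bij_betw_varphi\<close> and \<open>mirror_binary_trees\<close> below.\<close>

definition tphi :: "nat \<Rightarrow> nat ptree \<Rightarrow> nat ptree" where
  "tphi n T = the_inv_into (plane_trees n) varphi (mirror (varphi T))"

text \<open>\<open>New v\<close> is the added node named \<open>v'\<close>. In \<open>complete p B\<close>, the function \<open>p\<close> is the parent function of the
  plane tree. All nodes \<open>Old v\<close> get two children; the added nodes have none.\<close>

datatype 'a cnode = Old 'a | New 'a

fun complete :: "('a \<Rightarrow> 'a) \<Rightarrow> 'a tree \<Rightarrow> 'a cnode tree" where
  "complete p \<langle>\<rangle> = \<langle>\<rangle>"
| "complete p \<langle>l, v, r\<rangle> =
     \<langle>if l = \<langle>\<rangle> then \<langle>\<langle>\<rangle>, New v, \<langle>\<rangle>\<rangle> else complete p l,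
      Old v,
      if r = \<langle>\<rangle> then \<langle>\<langle>\<rangle>, New (p v), \<langle>\<rangle>\<rangle> else complete p r\<rangle>"

definition complement :: "'a ptree \<Rightarrow> 'a cnode tree" where
  "complement T = complete (parent T) (varphi T)"

definition leadsto :: "nat \<Rightarrow> nat ptree \<Rightarrow> nat \<Rightarrow> nat \<Rightarrow> bool" where
  "leadsto n T v u \<longleftrightarrow> v \<in> set_ptree T \<and> u \<in> set_ptree T \<and>
     (right_child (complement T) (Old u) (New v) \<or>
      right_child (complement (tphi n T)) (Old v) (New u))"

fun to_bin :: "'a ptree list \<Rightarrow> 'a tree" where
  "to_bin [] = \<langle>\<rangle>"
| "to_bin (PNode x us # ts) = \<langle>to_bin us, x, to_bin ts\<rangle>"

fun from_bin :: "'a tree \<Rightarrow> 'a ptree list" where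
  "from_bin \<langle>\<rangle> = []"
| "from_bin \<langle>l, x, r\<rangle> = PNode x (from_bin l) # from_bin r"

abbreviation fchildren :: "'a ptree list \<Rightarrow> 'a \<Rightarrow> 'a list" where
  "fchildren ts v \<equiv> concat (map (\<lambda>t. children t v) ts)"

lemma to_from_bin [simp]: "to_bin (from_bin B) = B"
  by (induction B) auto

lemma from_to_bin [simp]: "from_bin (to_bin ts) = ts"
  by (induction ts rule: to_bin.induct) auto

lemma preorder_to_bin: "preorder (to_bin ts) = concat (map names ts)"
  by (induction ts rule: to_bin.induct) auto

lemma set_to_bin: "set_tree (to_bin ts) = (\<Union>t\<in>set ts. set_ptree t)"
  by (induction ts rule: to_bin.induct) auto

lemma fchildren_notin: "v \<notin> set_tree (to_bin ts) \<Longrightarrow> fchildren ts v = []"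
  by (induction ts rule: to_bin.induct) auto

lemma root_to_bin: "(\<exists>l r. to_bin ts = \<langle>l, y, r\<rangle>) \<longleftrightarrow> (\<exists>cs. map root ts = y # cs)"
  by (cases ts rule: to_bin.cases) auto

lemma subtrees_set: "\<langle>l, x, r\<rangle> \<in> subtrees B \<Longrightarrow> x \<in> set_tree B"
  by (induction B) auto

lemma left_child_Node:
  "left_child \<langle>L, a, R\<rangle> x y \<longleftrightarrow>
     (x = a \<and> (\<exists>l r. L = \<langle>l, y, r\<rangle>)) \<or> left_child L x y \<or> left_child R x y"
  unfolding left_child_def by auto

lemma right_child_Node:
  "right_child \<langle>L, a, R\<rangle> x y \<longleftrightarrow>
     (x = a \<and> (\<exists>l r. R = \<langle>l, y, r\<rangle>)) \<or> right_child L x y \<or> right_child R x y"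
  unfolding right_child_def by auto

lemma left_child_Leaf: "\<not> left_child \<langle>\<rangle> x y"
  by (simp add: left_child_def)

lemma right_child_Leaf: "\<not> right_child \<langle>\<rangle> x y"
  by (simp add: right_child_def)

lemma left_child_in: "left_child B x y \<Longrightarrow> x \<in> set_tree B"
  unfolding left_child_def by (auto dest: subtrees_set)

lemma left_child_to_bin:
  assumes "distinct (preorder (to_bin ts))"
  shows "left_child (to_bin ts) x y \<longleftrightarrow> (\<exists>cs. fchildren ts x = y # cs)"
  using assms
proof (induction ts rule: to_bin.induct)
  case 1
  then show ?case by (simp add: left_child_Leaf)
next
  case (2 a us ts)
  have d: "a \<notin> set_tree (to_bin us)" "a \<notin> set_tree (to_bin ts)"
    "set_tree (to_bin us) \<inter> set_tree (to_bin ts) = {}"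
    using "2.prems" by auto
  have IH: "left_child (to_bin us) x y \<longleftrightarrow> (\<exists>cs. fchildren us x = y # cs)"
    "left_child (to_bin ts) x y \<longleftrightarrow> (\<exists>cs. fchildren ts x = y # cs)"
    using 2 by auto
  show ?case
  proof (cases "x = a")
    case True
    have "fchildren us a = []" "fchildren ts a = []" using d(1,2) by (blast intro: fchildren_notin)+
    moreover have "fchildren (PNode a us # ts) a = map root us @ fchildren ts a" by simp
    ultimately have "fchildren (PNode a us # ts) a = map root us" by (simp only: append_Nil2)
    moreover have "\<not> left_child (to_bin us) a y" "\<not> left_child (to_bin ts) a y"
      using d left_child_in by metis+
    ultimately show ?thesis
      using True by (simp only: to_bin.simps left_child_Node root_to_bin) blast
  next
    case False
    show ?thesis
    proof (cases "x \<in> set_tree (to_bin us)")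
      case True
      then have "fchildren ts x = []" using d by (intro fchildren_notin) auto
      then show ?thesis using False IH by (simp add: left_child_Node del: concat_eq_Nil_conv)
    next
      case out: False
      then have "fchildren us x = []" by (rule fchildren_notin)
      then show ?thesis using False IH by (simp add: left_child_Node del: concat_eq_Nil_conv)
    qed
  qed
qed

lemma adjacent_Cons:
  "(\<exists>as bs. a # xs = as @ x # y # bs) \<longleftrightarrow>
     (x = a \<and> (\<exists>cs. xs = y # cs)) \<or> (\<exists>as bs. xs = as @ x # y # bs)" (is "?l \<longleftrightarrow> ?r")
proof
  assume ?l
  then obtain as bs where "a # xs = as @ x # y # bs" by blast
  then show ?r by (cases as) auto
next
  assume ?r
  then show ?l by (metis append_Cons append_Nil)
qed

lemma right_child_to_bin:
  assumes "distinct (preorder (to_bin ts))"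
  shows "right_child (to_bin ts) x y \<longleftrightarrow>
    (\<exists>as bs. map root ts = as @ x # y # bs) \<or> (\<exists>w as bs. fchildren ts w = as @ x # y # bs)"
  using assms
proof (induction ts rule: to_bin.induct)
  case 1
  then show ?case by (simp add: right_child_Leaf)
next
  case (2 a us ts)
  let ?P = "\<lambda>xs. \<exists>as bs. xs = as @ x # y # bs"
  have d: "a \<notin> set_tree (to_bin us)" "a \<notin> set_tree (to_bin ts)"
    "set_tree (to_bin us) \<inter> set_tree (to_bin ts) = {}"
    using "2.prems" by auto
  have nil: "fchildren us a = []" "fchildren ts a = []"
    using d(1,2) by (blast intro: fchildren_notin)+
  have one: "fchildren us w = [] \<or> fchildren ts w = []" for w
    using d fchildren_notin[of w us] fchildren_notin[of w ts] by blast
  have IH: "right_child (to_bin us) x y \<longleftrightarrow> ?P (map root us) \<or> (\<exists>w. ?P (fchildren us w))"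
    "right_child (to_bin ts) x y \<longleftrightarrow> ?P (map root ts) \<or> (\<exists>w. ?P (fchildren ts w))"
    using 2 by auto
  have A: "?P (map root (PNode a us # ts)) \<longleftrightarrow>
      (x = a \<and> (\<exists>l r. to_bin ts = \<langle>l, y, r\<rangle>)) \<or> ?P (map root ts)"
    unfolding root_to_bin list.map ptree.sel by (rule adjacent_Cons)
  have B: "(\<exists>w. ?P (fchildren (PNode a us # ts) w)) \<longleftrightarrow>
      ?P (map root us) \<or> (\<exists>w. ?P (fchildren us w)) \<or> (\<exists>w. ?P (fchildren ts w))" (is "?l \<longleftrightarrow> ?r")
  proof
    assume ?l
    then obtain w where w: "?P (fchildren (PNode a us # ts) w)" by blast
    show ?r
    proof (cases "w = a")
      case True
      then have "?P (map root us)" using w nil by (simp del: concat_eq_Nil_conv)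
      then show ?thesis by blast
    next
      case False
      then have "?P (fchildren us w @ fchildren ts w)" using w by simp
      then have "?P (fchildren us w) \<or> ?P (fchildren ts w)"
        using one[of w] by (elim disjE) (simp_all only: append_Nil append_Nil2 simp_thms)
      then show ?thesis by blast
    qed
  next
    assume ?r
    then consider "?P (map root us)" | w where "?P (fchildren us w)" | w where "?P (fchildren ts w)"
      by blast
    then show ?l
    proof cases
      case 1
      then have "?P (fchildren (PNode a us # ts) a)" using nil by (simp del: concat_eq_Nil_conv)
      then show ?thesis by blast
    next
      case (2 w)
      then have "fchildren us w \<noteq> []" by (metis append_is_Nil_conv list.distinct(1))
      then have "w \<noteq> a" "fchildren ts w = []" using nil one[of w] by blast+
      then have "?P (fchildren (PNode a us # ts) w)" using 2 by (simp del: concat_eq_Nil_conv)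
      then show ?thesis by blast
    next
      case (3 w)
      then have "fchildren ts w \<noteq> []" by (metis append_is_Nil_conv list.distinct(1))
      then have "w \<noteq> a" "fchildren us w = []" using nil one[of w] by blast+
      then have "?P (fchildren (PNode a us # ts) w)" using 3 by (simp del: concat_eq_Nil_conv)
      then show ?thesis by blast
    qed
  qed
  show ?case
    using A B IH by (simp only: to_bin.simps right_child_Node) blast
qed

lemma subtrees_unique:
  assumes "distinct (preorder B)" "\<langle>l, x, r\<rangle> \<in> subtrees B" "\<langle>l', x, r'\<rangle> \<in> subtrees B"
  shows "l = l' \<and> r = r'"
  using assms by (induction B) (auto dest: subtrees_set)

lemma subtrees_trans: "s \<in> subtrees t \<Longrightarrow> t \<in> subtrees B \<Longrightarrow> s \<in> subtrees B"
  by (induction B) auto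

lemma tree_eqI:
  fixes B :: "'a tree"
  assumes B: "distinct (preorder B)" "B = \<langle>l, a, r\<rangle>"
    and B': "distinct (preorder B')" "B' = \<langle>l', a, r'\<rangle>"
    and lc: "\<And>x y. left_child B x y \<longleftrightarrow> left_child B' x y"
    and rc: "\<And>x y. right_child B x y \<longleftrightarrow> right_child B' x y"
  shows "B = B'"
proof -
  have key: "t = t'"
    if "t \<in> subtrees B" "t' \<in> subtrees B'" "t = \<langle>l1, x, r1\<rangle>" "t' = \<langle>l2, x, r2\<rangle>"
    for t t' l1 x r1 l2 r2
    using that
  proof (induction t arbitrary: t' l1 x r1 l2 r2)
    case Leaf
    then show ?case by simp
  next
    case (Node L z R)
    then have eqs: "L = l1" "z = x" "R = r1" by auto
    have self: "t \<in> subtrees t" for t :: "'a tree" by (cases t) auto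
    have sub: "L \<in> subtrees B" "R \<in> subtrees B" "l2 \<in> subtrees B'" "r2 \<in> subtrees B'"
      using Node.prems eqs subtrees_trans[of _ "\<langle>l1, x, r1\<rangle>" B]
        subtrees_trans[of _ "\<langle>l2, x, r2\<rangle>" B'] self by auto
    have t: "\<langle>L, x, R\<rangle> \<in> subtrees B" and t': "\<langle>l2, x, r2\<rangle> \<in> subtrees B'"
      using Node.prems by auto
    have "L = l2"
    proof (cases L)
      case Leaf
      show ?thesis
      proof (cases l2)
        case (Node p y q)
        then have "left_child B x y" using t' lc unfolding left_child_def by blast
        then show ?thesis using Leaf t subtrees_unique[OF B(1)] unfolding left_child_def by blast
      qed (use Leaf in simp)
    next
      case L: (Node p y q)
      then have "left_child B' x y" using t lc unfolding left_child_def by blast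
      then obtain p' q' where "l2 = \<langle>p', y, q'\<rangle>"
        using t' subtrees_unique[OF B'(1)] unfolding left_child_def by blast
      then show ?thesis using Node.IH(1) sub L by blast
    qed
    moreover have "R = r2"
    proof (cases R)
      case Leaf
      show ?thesis
      proof (cases r2)
        case (Node p y q)
        then have "right_child B x y" using t' rc unfolding right_child_def by blast
        then show ?thesis using Leaf t subtrees_unique[OF B(1)] unfolding right_child_def by blast
      qed (use Leaf in simp)
    next
      case R: (Node p y q)
      then have "right_child B' x y" using t rc unfolding right_child_def by blast
      then obtain p' q' where "r2 = \<langle>p', y, q'\<rangle>"
        using t' subtrees_unique[OF B'(1)] unfolding right_child_def by blast
      then show ?thesis using Node.IH(2) sub R by blast
    qed
    ultimately show ?case using Node.prems eqs by simp
  qed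
  have "B \<in> subtrees B" "B' \<in> subtrees B'" using B(2) B'(2) by auto
  then show ?thesis using B(2) B'(2) by (rule key)
qed

lemma set_subtrees: "s \<in> subtrees B \<Longrightarrow> set_tree s \<subseteq> set_tree B"
  by (induction B) auto

lemma left_child_in2: "left_child B x y \<Longrightarrow> y \<in> set_tree B"
  unfolding left_child_def by (auto dest!: set_subtrees)

lemma right_child_in: "right_child B x y \<Longrightarrow> x \<in> set_tree B \<and> y \<in> set_tree B"
  unfolding right_child_def by (auto dest!: set_subtrees)

lemma is_varphi_to_bin:
  assumes "distinct (names T)" "branches T \<noteq> []"
  shows "is_varphi T (to_bin (branches T))"
proof -
  obtain a ts where T: "T = PNode a ts" by (cases T)
  have d: "distinct (preorder (to_bin ts))" and a: "a \<notin> set_tree (to_bin ts)"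
    using assms T set_preorder[of "to_bin ts"] by (auto simp: preorder_to_bin)
  have S: "set_ptree T - {root T} = set_tree (to_bin ts)"
    using T a by (auto simp: set_to_bin)
  have nil: "fchildren ts a = []" using a by (rule fchildren_notin)
  have "(\<exists>w as bs. children T w = as @ x # y # bs) \<longleftrightarrow>
      (\<exists>as bs. map root ts = as @ x # y # bs) \<or> (\<exists>w as bs. fchildren ts w = as @ x # y # bs)"
    for x y
  proof -
    have c: "children T w = (if w = a then map root ts else fchildren ts w)" for w
      by (simp add: T)
    show ?thesis
      (is "?l \<longleftrightarrow> ?r")
    proof
      assume ?l
      then show ?r unfolding c by (metis (full_types))
    next
      assume ?r
      then consider as bs where "map root ts = as @ x # y # bs"
        | w as bs where "fchildren ts w = as @ x # y # bs" by blast
      then show ?l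
      proof cases
        case (1 as bs)
        then have "children T a = as @ x # y # bs" unfolding c by simp
        then show ?thesis by blast
      next
        case (2 w as bs)
        then have "w \<noteq> a" using nil by (metis append_is_Nil_conv list.distinct(1))
        then have "children T w = as @ x # y # bs" using 2 unfolding c by simp
        then show ?thesis by blast
      qed
    qed
  qed
  then have "right_child (to_bin ts) x y \<longleftrightarrow> closest_elder_sibling T x y" for x y
    unfolding closest_elder_sibling_def right_child_to_bin[OF d] by simp
  moreover have "left_child (to_bin ts) x y \<longleftrightarrow> (\<exists>cs. children T x = y # cs)"
    if "x \<in> set_tree (to_bin ts)" for x y
    using that a unfolding left_child_to_bin[OF d] by (auto simp: T)
  moreover have "\<exists>l r. to_bin ts = \<langle>l, hd (children T (root T)), r\<rangle>"
    using assms T by (cases ts rule: to_bin.cases) auto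
  ultimately show ?thesis
    unfolding is_varphi_def S using d by (simp add: T)
qed

lemma is_varphi_unique:
  assumes "is_varphi T B" "is_varphi T B'"
  shows "B = B'"
proof -
  obtain l r where B: "B = \<langle>l, hd (children T (root T)), r\<rangle>"
    using assms(1) unfolding is_varphi_def by blast
  obtain l' r' where B': "B' = \<langle>l', hd (children T (root T)), r'\<rangle>"
    using assms(2) unfolding is_varphi_def by blast
  show ?thesis
  proof (rule tree_eqI[OF _ B _ B'])
    show "left_child B x y \<longleftrightarrow> left_child B' x y" for x y
      using assms left_child_in left_child_in2 unfolding is_varphi_def by (metis (full_types))
    show "right_child B x y \<longleftrightarrow> right_child B' x y" for x y
      using assms right_child_in unfolding is_varphi_def by (metis (full_types))
  qed (use assms in \<open>auto simp: is_varphi_def\<close>)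
qed

lemma varphi_eq_to_bin:
  assumes "distinct (names T)" "branches T \<noteq> []"
  shows "varphi T = to_bin (branches T)"
  unfolding varphi_def
  using is_varphi_to_bin[OF assms] is_varphi_unique by blast

lemma varphi_plane_tree: "T \<in> plane_trees n \<Longrightarrow> varphi T = to_bin (branches T)"
  by (rule varphi_eq_to_bin) (auto simp: plane_trees_def)

lemma set_names: "set (names T) = set_ptree T"
  by (induction T) auto

lemma bij_betw_varphi: "bij_betw varphi (plane_trees n) (binary_trees n)"
proof (rule bij_betw_byWitness[where f' = "\<lambda>B. PNode 0 (from_bin B)"])
  show "\<forall>T\<in>plane_trees n. PNode 0 (from_bin (varphi T)) = T"
    by (auto simp: varphi_plane_tree) (auto simp: plane_trees_def)
  have *: "PNode 0 (from_bin B) \<in> plane_trees n" if "B \<in> binary_trees n" for B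
  proof -
    have d: "distinct (preorder B)" "set_tree B = {1..n}" "\<exists>l r. B = \<langle>l, 1, r\<rangle>"
      using that by (auto simp: binary_trees_def)
    have p: "concat (map names (from_bin B)) = preorder B"
      using preorder_to_bin[of "from_bin B"] by simp
    have "names (PNode 0 (from_bin B)) = 0 # preorder B" using p by simp
    moreover have "set_ptree (PNode 0 (from_bin B)) = insert 0 (set_tree B)"
      using set_to_bin[of "from_bin B"] by simp
    moreover have "insert 0 {1..n} = {0..n}" by auto
    ultimately show ?thesis using d by (auto simp: plane_trees_def)
  qed
  then show "\<forall>B\<in>binary_trees n. varphi (PNode 0 (from_bin B)) = B"
    by (simp add: varphi_plane_tree[OF *])
  show "(\<lambda>B. PNode 0 (from_bin B)) ` binary_trees n \<subseteq> plane_trees n"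
    using * by blast
  show "varphi ` plane_trees n \<subseteq> binary_trees n"
  proof safe
    fix T assume T: "T \<in> plane_trees n"
    then obtain us ts where T': "T = PNode 0 (PNode 1 us # ts)" by (auto simp: plane_trees_def)
    have d: "distinct (names T)" "set_ptree T = {0..n}" using T by (auto simp: plane_trees_def)
    have "is_varphi T (varphi T)"
      using is_varphi_to_bin[OF d(1)] T' varphi_plane_tree[OF T] by simp
    moreover have "{0..n} - {0} = {1..n}" by auto
    ultimately show "varphi T \<in> binary_trees n"
      unfolding is_varphi_def binary_trees_def using d T' by auto
  qed
qed

lemma mirror_binary_trees: "B \<in> binary_trees n \<Longrightarrow> mirror B \<in> binary_trees n"
proof -
  have sm: "set_tree (mirror t) = set_tree t" for t :: "'b tree"
    by (induction t) auto
  have "distinct (preorder (mirror t)) = distinct (preorder t)" for t :: "'b tree"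
    by (induction t) (auto simp: sm)
  then show "B \<in> binary_trees n \<Longrightarrow> mirror B \<in> binary_trees n"
    by (auto simp: binary_trees_def sm)
qed

end

theory Submission
  imports Defs
begin

text \<open>Reading a node of \<open>\<varphi>(T)\<close> as a word of left and right steps, the number of left steps is the
  level in \<open>T\<close> minus one and the number of right steps is the number of elder siblings met on the
  way to the root. An added node \<open>v'\<close> of the complement thus has \<open>lev v\<close> left and \<open>lsw v\<close> right
  steps, and its word ends in exactly \<open>deg v\<close> right steps and in exactly as many left steps as the
  dual degree of \<open>v\<close>. Mirroring exchanges left and right, and \<open>v \<leadsto> u\<close> says that the mirror image
  of \<open>v'\<close> is \<open>u'\<close>.\<close>

section \<open>Children in a plane tree with distinct names\<close>

lemma fchildren_Cons:
  "fchildren (PNode a us # ts) w =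
     (if w = a then map root us @ fchildren ts w else fchildren us w @ fchildren ts w)"
  by simp

text \<open>\<open>f w\<close> is the list of children of \<open>w\<close> in a plane forest with roots \<open>rs\<close> and node set \<open>S\<close>.\<close>

definition child_function :: "'a list \<Rightarrow> 'a set \<Rightarrow> ('a \<Rightarrow> 'a list) \<Rightarrow> bool" where
  "child_function rs S f \<longleftrightarrow> distinct rs \<and> set rs \<subseteq> S \<and> (\<forall>w. distinct (f w)) \<and>
     (\<forall>w. \<forall>x \<in> set (f w). x \<in> S \<and> x \<notin> set rs \<and> w \<in> S) \<and>
     (\<forall>w z. \<forall>x \<in> set (f w). x \<in> set (f z) \<longrightarrow> w = z)"

text \<open>One step of the recursion of \<open>to_bin\<close>: \<open>f\<close> belongs to the
  forest below \<open>a\<close>, \<open>g\<close> to the forest on its right. As \<open>U\<close>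
  and \<open>V\<close> are disjoint, at most one of \<open>f w\<close> and \<open>g w\<close> is
  nonempty, and both are empty at \<open>a\<close>.\<close>

lemma child_function_join:
  assumes U: "child_function rsU U f" and V: "child_function rsV V g"
    and d: "a \<notin> U" "a \<notin> V" "U \<inter> V = {}"
  shows "child_function (a # rsV) (insert a (U \<union> V)) (\<lambda>w. if w = a then rsU else f w @ g w)"
proof -
  let ?h = "\<lambda>w. if w = a then rsU else f w @ g w"
  have u: "x \<in> set (f w) \<Longrightarrow> x \<in> U \<and> x \<notin> set rsU \<and> w \<in> U" "x \<in> set rsU \<Longrightarrow> x \<in> U"
    "x \<in> set (f w) \<Longrightarrow> x \<in> set (f z) \<Longrightarrow> w = z" "distinct (f w)" "distinct rsU"
    and v: "x \<in> set (g w) \<Longrightarrow> x \<in> V \<and> x \<notin> set rsV \<and> w \<in> V" "x \<in> set rsV \<Longrightarrow> x \<in> V"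
    "x \<in> set (g w) \<Longrightarrow> x \<in> set (g z) \<Longrightarrow> w = z" "distinct (g w)" "distinct rsV" for x w z
    using U V unfolding child_function_def by blast+
  have mem: "x \<in> set (?h w) \<longleftrightarrow> w = a \<and> x \<in> set rsU \<or> x \<in> set (f w) \<or> x \<in> set (g w)" for x w
    using u(1) v(1) d by (cases "w = a") auto
  have "distinct (?h w)" for w
  proof -
    have "set (f w) \<inter> set (g w) = {}" using u(1) v(1) d(3) by blast
    then show ?thesis using u(4,5) v(4) by simp
  qed
  moreover have "w = z" if "x \<in> set (?h w)" "x \<in> set (?h z)" for x w z
    using that u(1-3) v(1-3) d unfolding mem by blast
  moreover have "x \<in> insert a (U \<union> V) \<and> x \<notin> set (a # rsV) \<and> w \<in> insert a (U \<union> V)"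
    if "x \<in> set (?h w)" for x w
    using that u(1,2) v(1,2) d unfolding mem insert_iff Un_iff list.set by blast
  moreover have "distinct (a # rsV)" "set (a # rsV) \<subseteq> insert a (U \<union> V)" using v(2,5) d by auto
  ultimately show ?thesis unfolding child_function_def by blast
qed

lemma child_function_fchildren:
  assumes "distinct (concat (map names ts))"
  shows "child_function (map root ts) (set_tree (to_bin ts)) (fchildren ts)"
  using assms
proof (induction ts rule: to_bin.induct)
  case 1
  then show ?case by (simp add: child_function_def)
next
  case (2 a us ts)
  have d: "a \<notin> set_tree (to_bin us)" "a \<notin> set_tree (to_bin ts)"
    "set_tree (to_bin us) \<inter> set_tree (to_bin ts) = {}"
    and "distinct (concat (map names us))" "distinct (concat (map names ts))"
    using 2(3) by (auto simp: set_to_bin set_names)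
  moreover have "fchildren (PNode a us # ts) =
    (\<lambda>w. if w = a then map root us else fchildren us w @ fchildren ts w)"
    using fchildren_notin[OF d(2)] by (auto simp: fun_eq_iff simp del: concat_eq_Nil_conv)
  moreover have "set_tree (to_bin (PNode a us # ts)) =
    insert a (set_tree (to_bin us) \<union> set_tree (to_bin ts))"
    by auto
  ultimately show ?case
    using child_function_join[OF 2(1,2)] by simp
qed

text \<open>Induction from the roots downwards. The roots of \<open>us\<close> are children of
  \<open>a\<close>, so \<open>P a\<close> starts the induction for \<open>us\<close>; the child
  lists of both subforests are contained in those of the whole forest, so the step premise is
  inherited.\<close>

lemma fchildren_induct:
  assumes "distinct (concat (map names ts))"
    and "x \<in> set_tree (to_bin ts)"
    and "\<And>y. y \<in> root ` set ts \<Longrightarrow> P y"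
    and "\<And>p y. P p \<Longrightarrow> y \<in> set (fchildren ts p) \<Longrightarrow> P y"
  shows "P x"
  using assms
proof (induction ts rule: to_bin.induct)
  case 1
  then show ?case by simp
next
  case (2 a us ts)
  let ?F = "PNode a us # ts"
  have d: "a \<notin> set_tree (to_bin us)" "a \<notin> set_tree (to_bin ts)"
    using 2(3) by (auto simp: set_to_bin set_names)
  have nil: "fchildren us a = []" "fchildren ts a = []"
    using d by (blast intro: fchildren_notin)+
  have a: "P a" using 2(5) by simp
  have sub: "set (fchildren us w) \<subseteq> set (fchildren ?F w) \<and> set (fchildren ts w) \<subseteq> set (fchildren ?F w)" for w
    unfolding fchildren_Cons
    by (cases "w = a") (simp_all only: nil simp_thms if_True if_False set_append list.set(1), blast+)
  have suba: "root ` set us \<subseteq> set (fchildren ?F a)"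
    unfolding fchildren_Cons by (simp only: nil simp_thms if_True set_append set_map, blast)
  have dU: "distinct (concat (map names us))" and dT: "distinct (concat (map names ts))"
    using 2(3) by simp_all
  have "P x" if "x \<in> set_tree (to_bin us)"
    using "2.IH"(1)[OF dU that] 2(6) sub suba a by blast
  moreover have "P x" if "x \<in> set_tree (to_bin ts)"
    using "2.IH"(2)[OF dT that] 2(5,6) sub by (meson image_mono set_subset_Cons subsetD)
  ultimately show ?case using 2(4) a by auto
qed

locale named_ptree =
  fixes T :: "'a ptree"
  assumes distinct_names: "distinct (names T)"
begin

lemma child_function: "child_function [root T] (set_ptree T) (children T)"
  using child_function_fchildren[of "[T]"] distinct_names by (simp add: set_to_bin)

lemma distinct_children: "distinct (children T p)"
  and root_not_child: "root T \<notin> set (children T p)"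
  and child_in: "x \<in> set (children T p) \<Longrightarrow> x \<in> set_ptree T"
  and child_parent_in: "x \<in> set (children T p) \<Longrightarrow> p \<in> set_ptree T"
  and parent_unique: "x \<in> set (children T p) \<Longrightarrow> x \<in> set (children T q) \<Longrightarrow> p = q"
  using child_function unfolding child_function_def by (auto, blast)

lemma node_induct [consumes 1, case_names root child]:
  assumes "x \<in> set_ptree T" "P (root T)" "\<And>p y. P p \<Longrightarrow> y \<in> set (children T p) \<Longrightarrow> P y"
  shows "P x"
  using fchildren_induct[of "[T]" x P] assms distinct_names by (auto simp: set_to_bin)

lemma parent_eq: "x \<in> set (children T p) \<Longrightarrow> parent T x = p"
  unfolding parent_def using parent_unique by blast

lemma ex_parent: "x \<in> set_ptree T \<Longrightarrow> x \<noteq> root T \<Longrightarrow> \<exists>p. x \<in> set (children T p)"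
  by (induction rule: node_induct) auto

section \<open>Recursion of the statistics along the path to the root\<close>

text \<open>The predicate under the \<open>THE\<close> of \<open>root_path\<close>, named so that
  \<open>node_induct\<close> can show that it has exactly one solution.\<close>

definition is_root_path :: "'a \<Rightarrow> 'a list \<Rightarrow> bool" where
  "is_root_path v p \<longleftrightarrow> p \<noteq> [] \<and> hd p = v \<and> last p = root T \<and>
                       successively (\<lambda>x y. x \<in> set (children T y)) p"

lemma is_root_path_root: "is_root_path (root T) p \<longleftrightarrow> p = [root T]"
proof
  assume p: "is_root_path (root T) p"
  then obtain q where q: "p = root T # q" by (cases p) (auto simp: is_root_path_def)
  then show "p = [root T]"
    using p root_not_child by (cases q) (auto simp: is_root_path_def)
qed (simp add: is_root_path_def)

lemma is_root_path_child:
  assumes "y \<in> set (children T p)"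
  shows "is_root_path y xs \<longleftrightarrow> (\<exists>q. xs = y # q \<and> is_root_path p q)"
proof
  assume *: "is_root_path y xs"
  then obtain q where q: "xs = y # q" by (cases xs) (auto simp: is_root_path_def)
  \<comment> \<open>Otherwise \<open>y\<close> would be the root, which is nobody's child.\<close>
  moreover have "q \<noteq> []" using * q assms root_not_child by (auto simp: is_root_path_def)
  ultimately show "\<exists>q. xs = y # q \<and> is_root_path p q"
    using * assms parent_unique by (cases q) (auto simp: is_root_path_def)
next
  assume "\<exists>q. xs = y # q \<and> is_root_path p q"
  then show "is_root_path y xs"
    using assms by (auto simp: is_root_path_def successively_Cons)
qed

lemma ex1_root_path: "v \<in> set_ptree T \<Longrightarrow> \<exists>!p. is_root_path v p"
  by (induction rule: node_induct) (auto simp: is_root_path_root is_root_path_child)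

lemma root_path_eqI:
  assumes "v \<in> set_ptree T" "is_root_path v p"
  shows "root_path T v = p"
  using ex1_root_path[OF assms(1)] assms(2)
  unfolding root_path_def is_root_path_def[symmetric] by blast

lemma is_root_path: "v \<in> set_ptree T \<Longrightarrow> is_root_path v (root_path T v)"
  using ex1_root_path root_path_eqI by metis

lemma root_in: "root T \<in> set_ptree T"
  by (rule ptree.set_sel)

lemma root_path_root: "root_path T (root T) = [root T]"
  using root_in by (simp add: root_path_eqI is_root_path_root)

lemma root_path_child:
  assumes "y \<in> set (children T p)"
  shows "root_path T y = y # root_path T p"
  using assms is_root_path[OF child_parent_in[OF assms]]
  by (intro root_path_eqI) (auto simp: child_in is_root_path_child)

lemma length_root_path_mono:
  "v \<in> set_ptree T \<Longrightarrow> z \<in> set (root_path T v) \<Longrightarrow> length (root_path T z) \<le> length (root_path T v)"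
  by (induction rule: node_induct) (auto simp: root_path_root root_path_child)

text \<open>Acyclicity by length: the nodes above \<open>p\<close> have root paths no longer than
  that of \<open>p\<close>, whereas the root path of a child of \<open>p\<close> is longer by
  one.\<close>

lemma child_notin_root_path:
  assumes "y \<in> set (children T p)"
  shows "y \<notin> set (root_path T p)"
  using length_root_path_mono[of p y] assms child_parent_in[OF assms] by (auto simp: root_path_child)

lemma in_root_path: "v \<in> set_ptree T \<Longrightarrow> v \<in> set (root_path T v)"
  by (induction rule: node_induct) (auto simp: root_path_root root_path_child)

lemma lev_root: "lev T (root T) = 0"
  by (simp add: lev_def root_path_root)

lemma lev_child:
  assumes "y \<in> set (children T p)"
  shows "lev T y = Suc (lev T p)"
  using in_root_path[OF child_parent_in[OF assms]] assms
  by (cases "root_path T p") (auto simp: lev_def root_path_child)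

section \<open>Elder siblings\<close>

lemma elder_sibling_common_parent:
  assumes "elder_sibling T x y"
  obtains w where "x \<in> set (children T w)" "y \<in> set (children T w)"
proof -
  obtain w as bs cs where "children T w = as @ x # bs @ y # cs"
    using assms unfolding elder_sibling_def by blast
  then have "x \<in> set (children T w)" "y \<in> set (children T w)" by simp_all
  then show ?thesis by (rule that)
qed

lemma elder_sibling_iff:
  assumes "children T p = as @ y # bs"
  shows "elder_sibling T x y \<longleftrightarrow> x \<in> set as"
proof
  assume "elder_sibling T x y"
  then obtain w as' bs' cs' where w: "children T w = as' @ x # bs' @ y # cs'"
    by (auto simp: elder_sibling_def)
  have "w = p" using parent_unique[of y w p] w assms by simp
  then have "as @ y # bs = (as' @ x # bs') @ y # cs'" using w assms by simp
  \<comment> \<open>Siblings are distinct, so their list splits at \<open>y\<close> in only one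
    way.\<close>
  moreover have "y \<notin> set as" "y \<notin> set bs" using distinct_children[of p] assms by simp_all
  ultimately have "as = as' @ x # bs'"
    using append_Cons_eq_iff[of y as bs "as' @ x # bs'" cs'] by blast
  then show "x \<in> set as" by simp
next
  assume "x \<in> set as"
  then obtain as1 as2 where "as = as1 @ x # as2" by (meson split_list)
  then have "children T p = as1 @ x # as2 @ y # bs" using assms by simp
  then show "elder_sibling T x y" unfolding elder_sibling_def by blast
qed

lemma elder_sibling_child: "elder_sibling T x y \<Longrightarrow> y \<in> set (children T p) \<Longrightarrow> x \<in> set (children T p)"
  using elder_sibling_common_parent parent_unique by metis

lemma not_elder_sibling_root: "\<not> elder_sibling T x (root T)"
  using elder_sibling_common_parent root_not_child by metis

lemma has_elder_iff: "children T p = as @ y # bs \<Longrightarrow> has_elder T y \<longleftrightarrow> as \<noteq> []"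
  unfolding has_elder_def by (simp add: elder_sibling_iff ex_in_conv)

lemma not_has_elder_root: "\<not> has_elder T (root T)"
  by (simp add: has_elder_def not_elder_sibling_root)

section \<open>Left spanning width: the edges to the left of the root path\<close>

definition left_edges :: "'a \<Rightarrow> ('a \<times> 'a) set" where
  "left_edges v = {(w, x). w \<in> set (root_path T v) - {v} \<and> x \<in> set (children T w) \<and>
                   (\<exists>y \<in> set (root_path T v). elder_sibling T x y)}"

text \<open>The degree is split off because only the remaining count obeys a recursion from parent
  to child.\<close>

lemma lsw_eq: "lsw T v = deg T v + card (left_edges v)"
  by (simp add: lsw_def deg_def left_edges_def)

lemma finite_left_edges: "finite (left_edges v)"
  by (rule finite_subset[of _ "Sigma (set (root_path T v)) (\<lambda>w. set (children T w))"])
    (auto simp: left_edges_def)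

lemma card_left_edges_root: "card (left_edges (root T)) = 0"
  by (simp add: left_edges_def root_path_root)

text \<open>Going down to \<open>y\<close> admits \<open>p\<close> as a first component, which
  \<open>left_edges p\<close> excludes; the edges gained lead to the elder siblings of
  \<open>y\<close>.\<close>

lemma left_edges_child:
  assumes "children T p = as @ y # bs"
  shows "left_edges y = left_edges p \<union> Pair p ` set as"
proof -
  have y: "y \<in> set (children T p)" using assms by simp
  have p: "p \<in> set (root_path T p)" using in_root_path child_parent_in[OF y] .
  have as: "set as \<subseteq> set (children T p)" using assms by auto
  have "(w, x) \<in> left_edges y \<longleftrightarrow> (w, x) \<in> left_edges p \<union> Pair p ` set as" for w x
  proof (cases "w = p")
    case True
    \<comment> \<open>Such a \<open>z\<close> is a child of \<open>p\<close>, and no child of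
      \<open>p\<close> lies on the root path of \<open>p\<close>.\<close>
    have "z = y" if z: "z \<in> insert y (set (root_path T p))" "x \<in> set (children T p)" "elder_sibling T x z"
      for z
    proof -
      have "z \<in> set (children T p)"
        using elder_sibling_common_parent[OF z(3)] parent_unique z(2) by metis
      then show ?thesis using child_notin_root_path z(1) by blast
    qed
    then show ?thesis
      using True p as child_notin_root_path[OF y] elder_sibling_iff[OF assms]
      by (auto simp: left_edges_def root_path_child[OF y])
  next
    case False
    \<comment> \<open>All elder siblings of \<open>y\<close> are children of \<open>p\<close>, so
      \<open>y\<close> contributes nothing at another \<open>w\<close>.\<close>
    have "\<not> elder_sibling T x y" if "x \<in> set (children T w)"
      using elder_sibling_child[OF _ y] parent_unique[OF that] False by blast
    then show ?thesis
      using False child_notin_root_path[OF y] by (auto simp: left_edges_def root_path_child[OF y])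
  qed
  then show ?thesis by auto
qed

lemma card_left_edges_child:
  assumes "children T p = as @ y # bs"
  shows "card (left_edges y) = card (left_edges p) + length as"
proof -
  have "left_edges p \<inter> Pair p ` set as = {}" by (auto simp: left_edges_def)
  moreover have "card (Pair p ` set as) = length as"
    using distinct_children[of p] assms
    by (subst card_image) (auto simp: inj_on_def distinct_card)
  ultimately show ?thesis
    by (simp add: left_edges_child[OF assms] card_Un_disjoint finite_left_edges)
qed

lemma card_left_edges_first_child:
  "children T p = y # bs \<Longrightarrow> card (left_edges y) = card (left_edges p)"
  using card_left_edges_child[of p "[]" y bs] by simp

lemma next_sibling:
  assumes "children T p = as @ x # y # bs"
  shows "lev T y = lev T x" and "card (left_edges y) = Suc (card (left_edges x))"
  using assms card_left_edges_child[of p as x "y # bs"] card_left_edges_child[of p "as @ [x]" y bs]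
    lev_child[of x p] lev_child[of y p] by simp_all

section \<open>Final runs of equal steps: elder siblings and dual degree\<close>

definition elder_count :: "'a \<Rightarrow> nat" where
  "elder_count y = card {x. elder_sibling T x y}"

lemma elder_count_eq:
  assumes "children T p = as @ y # bs"
  shows "elder_count y = length as"
  using distinct_children[of p] assms
  by (simp add: elder_count_def elder_sibling_iff[OF assms] distinct_card)

text \<open>\<open>run v\<close> is the dual degree that a leaf at the position of \<open>v\<close> would have.\<close>

definition run :: "'a \<Rightarrow> nat" where
  "run v = (if \<forall>w \<in> set (root_path T v). \<not> has_elder T w then lev T v
            else length (takeWhile (\<lambda>w. \<not> has_elder T w) (root_path T v)) + 1)"

lemma dual_deg_eq: "dual_deg T v = (if children T v = [] then run v else 0)"
  by (simp add: dual_deg_def run_def)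

lemma run_root: "run (root T) = 0"
  by (simp add: run_def root_path_root not_has_elder_root lev_root)

text \<open>Both branches of \<open>run\<close> grow by one: the level does, and so does the initial
  stretch of nodes without elder siblings, as \<open>y\<close> has none.\<close>

lemma run_first_child: "children T p = y # bs \<Longrightarrow> run y = Suc (run p)"
  using has_elder_iff[of p "[]" y bs] root_path_child[of y p] lev_child[of y p] by (simp add: run_def)

text \<open>\<open>y\<close> itself has an elder sibling, so the \<open>takeWhile\<close> is empty
  and only the added 1 remains.\<close>

lemma run_later_child: "children T p = as @ y # bs \<Longrightarrow> as \<noteq> [] \<Longrightarrow> run y = 1"
  using has_elder_iff[of p as y bs] root_path_child[of y p] by (simp add: run_def)

end

section \<open>Mirror images\<close>

text \<open>Structural induction would cut off the part of the tree above a node. This rule follows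
  the edges of one fixed \<open>B\<close> from its root, and each edge has a meaning in the plane
  tree: first child or next sibling.\<close>

lemma tree_reach_induct [consumes 1, case_names root left right]:
  assumes "x \<in> set_tree B"
    and "\<And>l a r. B = \<langle>l, a, r\<rangle> \<Longrightarrow> P a"
    and "\<And>x y. P x \<Longrightarrow> left_child B x y \<Longrightarrow> P y"
    and "\<And>x y. P x \<Longrightarrow> right_child B x y \<Longrightarrow> P y"
  shows "P x"
  using assms
proof (induction B)
  case Leaf
  from Leaf.prems(1) show ?case by simp
next
  case (Node l a r)
  have a: "P a" by (rule Node.prems(2)) (rule refl)
  have "P x" if "x \<in> set_tree l"
  proof (rule Node.IH(1)[OF that])
    show "P b" if "l = \<langle>l', b, r'\<rangle>" for l' b r'
      by (rule Node.prems(3)[OF a]) (simp add: left_child_Node that)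
    show "P z" if "P y" "left_child l y z" for y z
      by (rule Node.prems(3)[OF that(1)]) (simp add: left_child_Node that(2))
    show "P z" if "P y" "right_child l y z" for y z
      by (rule Node.prems(4)[OF that(1)]) (simp add: right_child_Node that(2))
  qed
  moreover have "P x" if "x \<in> set_tree r"
  proof (rule Node.IH(2)[OF that])
    show "P b" if "r = \<langle>l', b, r'\<rangle>" for l' b r'
      by (rule Node.prems(4)[OF a]) (simp add: right_child_Node that)
    show "P z" if "P y" "left_child r y z" for y z
      by (rule Node.prems(3)[OF that(1)]) (simp add: left_child_Node that(2))
    show "P z" if "P y" "right_child r y z" for y z
      by (rule Node.prems(4)[OF that(1)]) (simp add: right_child_Node that(2))
  qed
  ultimately show ?case using Node.prems(1) a unfolding tree.set by blast
qed

lemma root_mirror: "(\<exists>l r. mirror B = \<langle>l, y, r\<rangle>) \<longleftrightarrow> (\<exists>l r. B = \<langle>l, y, r\<rangle>)"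
  by (cases B) auto

lemma left_child_mirror: "left_child (mirror B) x y \<longleftrightarrow> right_child B x y"
proof (induction B)
  case (Node l a r)
  then show ?case
    by (simp only: mirror.simps left_child_Node right_child_Node root_mirror) blast
qed (simp add: left_child_Leaf right_child_Leaf)

lemma right_child_mirror: "right_child (mirror B) x y \<longleftrightarrow> left_child B x y"
  using left_child_mirror[of "mirror B" x y] by simp

section \<open>Added right children in the complement\<close>

lemma root_complete: "complete p B \<noteq> \<langle>l, New x, r\<rangle>"
  by (cases B) auto

text \<open>By \<open>root_complete\<close> a completed subtree never has an added node as its root,
  so an added right child stands only where the right subtree of \<open>u\<close> was empty.\<close>

lemma right_child_complete:
  assumes "right_child (complete p B) (Old u) (New v)"
  shows "v = p u \<and> (\<exists>l. \<langle>l, u, \<langle>\<rangle>\<rangle> \<in> subtrees B)"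
  using assms
proof (induction B)
  case Leaf
  then show ?case by (simp add: right_child_Leaf)
next
  case (Node l a r)
  have "\<not> right_child \<langle>\<langle>\<rangle>, New b, \<langle>\<rangle>\<rangle> x y" for b and x y :: "'a cnode"
    by (simp add: right_child_Node right_child_Leaf)
  with Node show ?case
    by (auto simp: right_child_Node root_complete split: if_splits)
qed

lemma not_right_child: "distinct (preorder B) \<Longrightarrow> \<langle>l, u, \<langle>\<rangle>\<rangle> \<in> subtrees B \<Longrightarrow> \<not> right_child B u y"
  unfolding right_child_def using subtrees_unique by (metis tree.distinct(1))

section \<open>Two plane trees whose binary trees are mirror images\<close>

locale mirror_pair =
  A: named_ptree A + A': named_ptree A' for A A' :: "'a ptree" +
  fixes B
  assumes varphi: "is_varphi A B" and varphi': "is_varphi A' (mirror B)"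
    and node_set: "set_ptree A' = set_ptree A" and roots: "root A' = root A"
begin

text \<open>\<open>mirror\<close> is an involution, so every fact about the pair also holds with
  \<open>A\<close> and \<open>A'\<close> exchanged. The swapped interpretation reads edges of
  \<open>mirror B\<close> as child and sibling relations of \<open>A'\<close>.\<close>

lemma swap: "mirror_pair A' A (mirror B)"
  using varphi varphi' node_set roots by unfold_locales simp_all

lemma set_tree_B: "set_tree B = set_ptree A - {root A}"
  using varphi by (simp add: is_varphi_def)

lemma left_child_first:
  assumes "left_child B x y"
  obtains cs where "children A x = y # cs"
  using assms varphi left_child_in[OF assms] left_child_in2[OF assms]
  unfolding is_varphi_def by blast

lemma right_child_next:
  assumes "right_child B x y"
  obtains w as bs where "children A w = as @ x # y # bs"
  using assms varphi right_child_in[OF assms]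
  unfolding is_varphi_def closest_elder_sibling_def by blast

text \<open>The first child of \<open>u\<close> in \<open>A'\<close> would be its left child in
  \<open>mirror B\<close>, hence its right child in \<open>B\<close>.\<close>

lemma leaf_if_last:
  assumes "u \<in> set_tree B" "\<And>y. \<not> right_child B u y"
  shows "children A' u = []"
proof (cases "children A' u")
  case (Cons y ys)
  then have y: "y \<in> set (children A' u)" by simp
  have "u \<in> set_ptree A' - {root A'}" "y \<in> set_ptree A' - {root A'}"
    using assms(1) set_tree_B node_set roots A'.child_in[OF y] A'.root_not_child y by auto
  then have "left_child (mirror B) u y"
    using varphi' Cons unfolding is_varphi_def by blast
  then show ?thesis using assms(2) by (simp add: left_child_mirror)
qed

text \<open>A next sibling of \<open>u\<close> would be its right child in \<open>B\<close>. The
  parent exists because the root of \<open>A\<close> is not a node of \<open>B\<close>.\<close>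

lemma last_child:
  assumes "u \<in> set_tree B" "\<And>y. \<not> right_child B u y"
  obtains as where "children A (parent A u) = as @ [u]"
proof -
  obtain p where p: "u \<in> set (children A p)"
    using A.ex_parent assms(1) set_tree_B by auto
  then obtain as bs where s: "children A p = as @ u # bs" by (meson split_list)
  have "bs = []"
  proof (cases bs)
    case (Cons y ys)
    then have "closest_elder_sibling A u y" using s unfolding closest_elder_sibling_def by blast
    moreover have y: "y \<in> set (children A p)" using s Cons by simp
    moreover have "y \<in> set_ptree A - {root A}"
      using A.child_in[OF y] A.root_not_child[of p] y by auto
    ultimately have "right_child B u y"
      using varphi assms(1) set_tree_B unfolding is_varphi_def by blast
    then show ?thesis using assms(2) by blast
  qed
  then show ?thesis using that s A.parent_eq[OF p] by simp
qed

lemma root_first_child: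
  assumes "B = \<langle>l, a, r\<rangle>"
  obtains cs where "children A (root A) = a # cs"
proof (cases "children A (root A)")
  \<comment> \<open>Here the \<open>hd\<close> in \<open>is_varphi\<close> is unspecified. The case
    is impossible: the root would be the only node of \<open>A\<close>, but \<open>B\<close>
    contains \<open>a\<close>.\<close>
  case Nil
  have "x = root A" if "x \<in> set_ptree A" for x
    using that by (induction rule: A.node_induct) (use Nil in auto)
  then show ?thesis using assms set_tree_B by auto
next
  case (Cons b cs)
  then have "a = b" using varphi assms by (auto simp: is_varphi_def)
  then show ?thesis using that Cons by simp
qed

text \<open>Along a left edge of \<open>B\<close> the lower node is a first child in
  \<open>A\<close> and a next sibling in \<open>A'\<close>; along a right edge it is the other way
  round. A first child raises the level by one and keeps the left edges, a next sibling does the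
  opposite. The \<open>Suc\<close> comes from the root of \<open>B\<close>, which has level 1 and no
  left edges in both trees.\<close>

lemma lev_left_edges_mirror:
  assumes "x \<in> set_tree B"
  shows "lev A' x = Suc (card (A.left_edges x)) \<and> lev A x = Suc (card (A'.left_edges x))"
  using assms
proof (induction rule: tree_reach_induct)
  case (root l a r)
  interpret S: mirror_pair A' A "mirror B" by (rule swap)
  obtain cs where cs: "children A (root A) = a # cs" using root_first_child root by blast
  obtain cs' where cs': "children A' (root A') = a # cs'"
    using S.root_first_child[of "mirror r" a "mirror l"] root by auto
  have "a \<in> set (children A (root A))" "a \<in> set (children A' (root A'))" by (simp_all add: cs cs')
  then show ?case
    using A.card_left_edges_first_child[OF cs] A'.card_left_edges_first_child[OF cs']
    by (simp add: A.lev_child A'.lev_child A.lev_root A'.lev_root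
        A.card_left_edges_root A'.card_left_edges_root)
next
  case (left x y)
  interpret S: mirror_pair A' A "mirror B" by (rule swap)
  obtain cs where cs: "children A x = y # cs" using left_child_first left by blast
  obtain w as bs where w: "children A' w = as @ x # y # bs"
    using S.right_child_next left right_child_mirror by metis
  have "y \<in> set (children A x)" by (simp add: cs)
  then show ?case
    using A.card_left_edges_first_child[OF cs] A'.next_sibling[OF w] left by (simp add: A.lev_child)
next
  case (right x y)
  interpret S: mirror_pair A' A "mirror B" by (rule swap)
  obtain cs where cs: "children A' x = y # cs" using S.left_child_first right left_child_mirror by metis
  obtain w as bs where w: "children A w = as @ x # y # bs" using right_child_next right by blast
  have "y \<in> set (children A' x)" by (simp add: cs)
  then show ?case
    using A'.card_left_edges_first_child[OF cs] A.next_sibling[OF w] right by (simp add: A'.lev_child)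
qed

text \<open>Along a right edge of \<open>B\<close> both sides grow by one. A left edge resets both:
  the lower node is a later child in \<open>A'\<close>, with run 1, and a first child in
  \<open>A\<close>, with no elder siblings.\<close>

lemma run_mirror:
  assumes "x \<in> set_tree B"
  shows "A'.run x = Suc (A.elder_count x)"
  using assms
proof (induction rule: tree_reach_induct)
  case (root l a r)
  interpret S: mirror_pair A' A "mirror B" by (rule swap)
  obtain cs where cs: "children A (root A) = [] @ a # cs" using root_first_child root by auto
  obtain cs' where cs': "children A' (root A') = a # cs'"
    using S.root_first_child[of "mirror r" a "mirror l"] root by auto
  show ?case
    by (simp add: A'.run_first_child[OF cs'] A'.run_root A.elder_count_eq[OF cs])
next
  case (left x y)
  interpret S: mirror_pair A' A "mirror B" by (rule swap)
  obtain cs where cs: "children A x = [] @ y # cs" using left_child_first[OF left(2)] by auto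
  obtain w as bs where "children A' w = as @ x # y # bs"
    using S.right_child_next left right_child_mirror by metis
  then have w: "children A' w = (as @ [x]) @ y # bs" by simp
  show ?case
    by (simp add: A'.run_later_child[OF w] A.elder_count_eq[OF cs])
next
  case (right x y)
  interpret S: mirror_pair A' A "mirror B" by (rule swap)
  obtain cs where cs: "children A' x = y # cs" using S.left_child_first right left_child_mirror by metis
  obtain w as bs where w: "children A w = as @ x # y # bs" using right_child_next right by blast
  then have w': "children A w = (as @ [x]) @ y # bs" by simp
  show ?case
    using right by (simp add: A'.run_first_child[OF cs] A.elder_count_eq[OF w] A.elder_count_eq[OF w'])
qed

text \<open>The common situation of both cases of the definition of \<open>\<leadsto>\<close>: the node \<open>v'\<close> is the right child
  of \<open>u\<close> in one complement, so its mirror image is the left child of \<open>u\<close> in the other, named \<open>u'\<close>.\<close>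

lemma last_child_stats:
  assumes "u \<in> set_tree B" "\<And>y. \<not> right_child B u y"
  defines "v \<equiv> parent A u"
  shows "lev A v = lsw A' u" "lsw A v = lev A' u"
    "deg A v = dual_deg A' u" "dual_deg A v = 0" "deg A' u = 0"
proof -
  obtain as where ch: "children A v = as @ [u]" using last_child assms by metis
  have u: "u \<in> set (children A v)" using ch by simp
  have leaf: "children A' u = []" using leaf_if_last assms by blast
  show deg: "deg A' u = 0" by (simp add: deg_def leaf)
  \<comment> \<open>Both sides are one less than the level of \<open>u\<close> in \<open>A\<close>;
    the leaf \<open>u\<close> has only left edges to count in \<open>A'\<close>.\<close>
  show "lev A v = lsw A' u"
    using lev_left_edges_mirror[OF assms(1)] A.lev_child[OF u] by (simp add: A'.lsw_eq deg)
  \<comment> \<open>As \<open>u\<close> is the last child, all other children of \<open>v\<close>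
    are its elder siblings. So the degree exceeds their number by one, just as the run of
    \<open>u\<close> in \<open>A'\<close> does, and together with the left edges of \<open>v\<close>
    it gives the level of \<open>u\<close> in \<open>A'\<close>.\<close>
  have "deg A v = Suc (length as)" by (simp add: deg_def ch)
  then show "lsw A v = lev A' u" "deg A v = dual_deg A' u"
    using lev_left_edges_mirror[OF assms(1)] A.card_left_edges_child[OF ch]
      run_mirror[OF assms(1)] A.elder_count_eq[OF ch]
    by (simp_all add: A.lsw_eq A'.dual_deg_eq leaf)
  show "dual_deg A v = 0" by (simp add: A.dual_deg_eq ch)
qed

end

section \<open>The involution and the two cases of the relation\<close>

lemma is_varphi_varphi:
  assumes "T \<in> plane_trees n"
  shows "is_varphi T (varphi T)"
  unfolding varphi_plane_tree[OF assms]
  using assms by (intro is_varphi_to_bin) (auto simp: plane_trees_def)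

lemma mirror_pair_tphi:
  assumes "T \<in> plane_trees n"
  shows "mirror_pair T (tphi n T) (varphi T)"
    and "tphi n T \<in> plane_trees n" and "varphi (tphi n T) = mirror (varphi T)"
proof -
  have inj: "inj_on varphi (plane_trees n)" and im: "varphi ` plane_trees n = binary_trees n"
    using bij_betw_varphi by (simp_all add: bij_betw_def)
  have "varphi T \<in> binary_trees n" using im assms by blast
  \<comment> \<open>\<open>the_inv_into\<close> is meaningful only on the image of
    \<open>varphi\<close>, so membership there comes first.\<close>
  then have m: "mirror (varphi T) \<in> varphi ` plane_trees n"
    unfolding im by (rule mirror_binary_trees)
  show T': "tphi n T \<in> plane_trees n"
    unfolding tphi_def by (rule the_inv_into_into[OF inj m subset_refl])
  show eq: "varphi (tphi n T) = mirror (varphi T)"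
    unfolding tphi_def by (rule f_the_inv_into_f[OF inj m])
  have "is_varphi (tphi n T) (mirror (varphi T))"
    using is_varphi_varphi[OF T'] unfolding eq .
  then show "mirror_pair T (tphi n T) (varphi T)"
    using assms T' is_varphi_varphi[OF assms]
    by unfold_locales (auto simp: plane_trees_def)
qed

lemma right_child_complement:
  assumes "T \<in> plane_trees n" "right_child (complement T) (Old u) (New v)"
  shows "v = parent T u" and "u \<in> set_tree (varphi T)" and "\<not> right_child (varphi T) u y"
proof -
  obtain l where l: "\<langle>l, u, \<langle>\<rangle>\<rangle> \<in> subtrees (varphi T)" and v: "v = parent T u"
    using right_child_complete[OF assms(2)[unfolded complement_def]] by blast
  have "distinct (preorder (varphi T))"
    using is_varphi_varphi[OF assms(1)] unfolding is_varphi_def by blast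
  then show "\<not> right_child (varphi T) u y" using l by (rule not_right_child)
  show "u \<in> set_tree (varphi T)" using l by (rule subtrees_set)
  show "v = parent T u" by (rule v)
qed

theorem theorem2p2:
  fixes n :: nat and T :: "nat ptree" and v u :: nat
  assumes "n \<ge> 1"
    and "T \<in> plane_trees n"
    and "v \<in> set_ptree T"
    and "leadsto n T v u"
  shows "lev T v = lsw (tphi n T) u \<and>
         lsw T v = lev (tphi n T) u \<and>
         deg T v = dual_deg (tphi n T) u"
proof -
  note tphi = mirror_pair_tphi[OF assms(2)]
  interpret S: mirror_pair T "tphi n T" "varphi T" by (rule tphi(1))
  interpret S': mirror_pair "tphi n T" T "varphi (tphi n T)"
    unfolding tphi(3) by (rule S.swap)
  from assms(4) consider "right_child (complement T) (Old u) (New v)"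
    | "right_child (complement (tphi n T)) (Old v) (New u)"
    unfolding leadsto_def by blast
  then show ?thesis
  proof cases
    case 1
    note c = right_child_complement[OF assms(2) 1]
    show ?thesis using S.last_child_stats[OF c(2,3)] c(1) by simp
  next
    \<comment> \<open>Now \<open>u\<close> is the parent of \<open>v\<close> in
      \<open>tphi n T\<close>, and the two trees exchange roles. The degree equation becomes 0 = 0:
      \<open>v\<close> is a leaf of \<open>T\<close> and \<open>u\<close> is internal in
      \<open>tphi n T\<close>.\<close>
    case 2
    note c = right_child_complement[OF tphi(2) 2]
    show ?thesis using S'.last_child_stats[OF c(2,3)] c(1) by simp
  qed
qed

end
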